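(* Let $n\in\mathbb N$, let $U,V\subset\mathbb R^n$ be domains, $(s,t)\subset\mathbb R$ an open interval, $\underline a=\sum_{i=1}^n a_ie_i\in C^1(U,V)$ a diffeomorphism with real-valued components, and $a:(s,t)\times U\to(s,t)\times V$, $a(x)=x_0+\underline a(\underline x)$. Suppose $a((s,t)\times U)=(s,t)\times V\subset\mathbb R^{n+1}$ is an axially symmetric s-domain, and let $f\in C^1((s,t)\times U,\mathbb R_{0,n})$. 1. If $f\circ a^{-1}\in\mathcal{SM}((s,t)\times V)$, then $\mathcal H_a[f]=0$ on $(s,t)\times U$. 2. If $f\circ a^{-1}\in\mathcal{HM}((s,t)\times V)$, then $\mathcal H_a[f]=0$ on $(s,t)\times U$.
   Context: $\mathbb R_{0,n}$ is the real Clifford algebra generated by $e_1,\dots,e_n$ with $e_ie_j+e_je_i=-2\delta_{ij}$. A point of $\mathbb R^{n+1}$ is identified with the paravector $x=x_0+\underline x$, $\underline x=\sum_{j=1}^n x_je_j$. $\mathbb S=\{\underline x:\ x_1^2+\dots+x_n^2=1\}$; for $I\in\mathbb S$, $I^2=-1$ and $\mathbb C_I=\mathbb R+I\mathbb R\subset\mathbb R^{n+1}$. "Diffeomorphism" means a $C^1$ bijection with $C^1$ inverse; $a^{-1}(y)=y_0+\sum_j(a^{-1})_j(\underline y)e_j$, with $(a^{-1})_j$ the $j$-th component of $(\underline a)^{-1}$. Operator: for $f\in C^1((s,t)\times U,\mathbb R_{0,n})$, $$\mathcal H_a(f)(x)=\underline a(\underline x)\frac{\partial f}{\partial x_0}(x)-\sum_{i=1}^n\Big(\sum_{j=1}^n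 a_j(\underline x)\Big(\frac{\partial(a^{-1})_i}{\partial y_j}\circ a\Big)(x)\Big)\frac{\partial f}{\partial x_i}(x).$$ A domain $W\subset\mathbb R^{n+1}$ is an s-domain if $W\cap\mathbb R\neq\emptyset$ and $W\cap\mathbb C_I$ is a domain in $\mathbb C_I$ for all $I\in\mathbb S$. $W$ is axially symmetric if $u+Iv\in W$ (with $u,v\in\mathbb R$, $I\in\mathbb S$) implies $u+Jv\in W$ for all $J\in\mathbb S$. $\mathcal{SM}(W)$: real differentiable $h:W\to\mathbb R_{0,n}$ with $\big(\frac{\partial}{\partial u}+I\frac{\partial}{\partial v}\big)h|_{W\cap\mathbb C_I}(u+Iv)=0$ on $W\cap\mathbb C_I$ for every $I\in\mathbb S$. $\mathcal{HM}(W)$ ($W$ axially symmetric open): functions of the form $h(u+Iv)=\alpha(u,v)+I\beta(u,v)$ for all $u+Iv\in W$, $I\in\mathbb S$, where $\alpha,\beta$ are differentiable $\mathbb R_{0,n}$-valued functions on $\{(u,v)\in\mathbb R^2: u+Iv\in W\}$ with $\alpha(u,v)=\alpha(u,-v)$, $\beta(u,v)=-\beta(u,-v)$, $\frac{\partial\alpha}{\partial u}-\frac{\partial\beta}{\partial v}=0$, $\frac{\partial\alpha}{\partial v}+\frac{\partial\beta}{\partial u}=0$. *)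

theory Defs
  imports "HOL-Analysis.Analysis"
begin

section \<open>The real Clifford algebra with n anticommuting imaginary units\<close>

text \<open>
  The number of generators is n = CARD('n); the linear order on the index type only fixes the
  order of the factors in the basis products e_A = e_{i_1} ... e_{i_k}, where
  A = {i_1 < ... < i_k}.  An element is its family of coordinates with respect to the e_A.  The
  product gets its own symbol because the library's times on vectors is the componentwise one.

  Sorting the factors of e_A e_B costs one sign for every pair (i, j) in A x B with j < i, and
  every common index contributes a further sign since e_i e_i = -1.
\<close>

type_synonym 'n clifford = "real ^ ('n set)"

definition cl_basis :: "'n set \<Rightarrow> ('n::{finite,linorder}) clifford" where
  "cl_basis A = axis A 1"

definition cl_sign :: "('n::{finite,linorder}) set \<Rightarrow> 'n set \<Rightarrow> real" where
  "cl_sign A B = (- 1) ^ card {(i, j). i \<in> A \<and> j \<in> B \<and> j \<le> i}"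

definition cl_mult :: "('n::{finite,linorder}) clifford \<Rightarrow> 'n clifford \<Rightarrow> 'n clifford"
    (infixl "\<star>" 70) where
  "x \<star> y = (\<Sum>A\<in>UNIV. \<Sum>B\<in>UNIV.
      (x $ A * y $ B * cl_sign A B) *\<^sub>R cl_basis ((A - B) \<union> (B - A)))"

abbreviation cl_one :: "('n::{finite,linorder}) clifford" where
  "cl_one \<equiv> cl_basis {}"

abbreviation cl_gen :: "'n \<Rightarrow> ('n::{finite,linorder}) clifford" where
  "cl_gen i \<equiv> cl_basis {i}"

definition cl_vec :: "real ^ ('n::{finite,linorder}) \<Rightarrow> 'n clifford" where
  "cl_vec v = (\<Sum>i\<in>UNIV. (v $ i) *\<^sub>R cl_gen i)"

lemma cl_mult_basis:
  "cl_basis A \<star> cl_basis B = cl_sign A B *\<^sub>R cl_basis ((A - B) \<union> (B - A))"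
proof -
  have "cl_basis A \<star> cl_basis B = (\<Sum>A'\<in>UNIV. \<Sum>B'\<in>UNIV. if A' = A then (if B' = B then
      cl_sign A B *\<^sub>R cl_basis ((A - B) \<union> (B - A)) else 0) else 0)"
    unfolding cl_mult_def
    by (intro sum.cong refl) (auto simp: cl_basis_def axis_def)
  also have "\<dots> = (\<Sum>A'\<in>UNIV. if A' = A then
      cl_sign A B *\<^sub>R cl_basis ((A - B) \<union> (B - A)) else 0)"
    by (intro sum.cong refl) (auto simp: sum.delta)
  finally show ?thesis by (simp add: sum.delta)
qed

lemma bilinear_cl_mult: "bilinear (\<star>)"
  unfolding bilinear_def
  by (intro allI conjI linearI)
     (simp_all add: cl_mult_def sum.distrib scaleR_sum_right distrib_left distrib_right
        scaleR_add_left mult_ac)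

lemma cl_mult_add_left: "(x + y) \<star> z = x \<star> z + y \<star> z"
  and cl_mult_add_right: "x \<star> (y + z) = x \<star> y + x \<star> z"
  and cl_mult_scale_left: "(c *\<^sub>R x) \<star> y = c *\<^sub>R (x \<star> y)"
  and cl_mult_scale_right: "x \<star> (c *\<^sub>R y) = c *\<^sub>R (x \<star> y)"
  by (rule bilinear_ladd[OF bilinear_cl_mult] bilinear_radd[OF bilinear_cl_mult]
      bilinear_lmul[OF bilinear_cl_mult] bilinear_rmul[OF bilinear_cl_mult])+

lemma cl_linear_eqI:
  fixes f g :: "('n::{finite,linorder}) clifford \<Rightarrow> 'n clifford"
  assumes "linear f" "linear g" "\<And>A. f (cl_basis A) = g (cl_basis A)"
  shows "f x = g x"
proof -
  have "f = g"
    using assms by (intro linear_eq_stdbasis) (auto simp: cl_basis_def Basis_vec_def)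
  then show ?thesis by simp
qed

lemma cl_one_left: "cl_one \<star> x = x"
proof -
  have b: "cl_one \<star> cl_basis A = (cl_basis A :: 'a clifford)" for A
    by (simp add: cl_mult_basis cl_sign_def)
  show ?thesis
    by (rule cl_linear_eqI[where f = "\<lambda>x. cl_one \<star> x" and g = "\<lambda>x. x"])
       (auto intro!: linearI simp: cl_mult_add_right cl_mult_scale_right b)
qed

lemma cl_one_right: "x \<star> cl_one = x"
proof -
  have b: "cl_basis A \<star> cl_one = (cl_basis A :: 'a clifford)" for A
    by (simp add: cl_mult_basis cl_sign_def)
  show ?thesis
    by (rule cl_linear_eqI[where f = "\<lambda>x. x \<star> cl_one" and g = "\<lambda>x. x"])
       (auto intro!: linearI simp: cl_mult_add_left cl_mult_scale_left b)
qed

lemma power_minus_one_symdiff: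
  assumes "finite P" "finite Q"
  shows "(- 1 :: real) ^ card ((P - Q) \<union> (Q - P)) = (- 1) ^ card P * (- 1) ^ card Q"
proof -
  have 1: "card P = card (P - Q) + card (P \<inter> Q)"
    using assms by (subst card_Un_disjoint[symmetric]) (auto intro: arg_cong[of _ _ card])
  have 2: "card Q = card (Q - P) + card (P \<inter> Q)"
    using assms by (subst card_Un_disjoint[symmetric]) (auto intro: arg_cong[of _ _ card])
  have 3: "card ((P - Q) \<union> (Q - P)) = card (P - Q) + card (Q - P)"
    using assms by (intro card_Un_disjoint) auto
  have 4: "(- 1 :: real) ^ card (P \<inter> Q) * (- 1) ^ card (P \<inter> Q) = 1"
    by (simp add: power_mult_distrib[symmetric])
  show ?thesis
    unfolding 1 2 3 power_add using 4 by (simp add: mult.assoc mult.left_commute)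
qed

lemma cl_sign_symdiff_left:
  "cl_sign ((A - B) \<union> (B - A)) C = cl_sign A C * cl_sign B C"
proof -
  let ?P = "\<lambda>A. {(i, j). i \<in> A \<and> j \<in> C \<and> j \<le> i}"
  have "?P ((A - B) \<union> (B - A)) = (?P A - ?P B) \<union> (?P B - ?P A)" by auto
  then show ?thesis
    unfolding cl_sign_def by (simp only:) (intro power_minus_one_symdiff finite)
qed

lemma cl_sign_symdiff_right:
  "cl_sign C ((A - B) \<union> (B - A)) = cl_sign C A * cl_sign C B"
proof -
  let ?P = "\<lambda>A. {(i, j). i \<in> C \<and> j \<in> A \<and> j \<le> i}"
  have "?P ((A - B) \<union> (B - A)) = (?P A - ?P B) \<union> (?P B - ?P A)" by auto
  then show ?thesis
    unfolding cl_sign_def by (simp only:) (intro power_minus_one_symdiff finite)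
qed

lemma cl_mult_assoc: "(x \<star> y) \<star> z = x \<star> (y \<star> z)"
proof -
  note lin = cl_mult_add_right cl_mult_scale_right cl_mult_add_left cl_mult_scale_left
  have symdiff_assoc:
    "((A - B) \<union> (B - A) - C) \<union> (C - ((A - B) \<union> (B - A)))
      = (A - ((B - C) \<union> (C - B))) \<union> ((B - C) \<union> (C - B) - A)"
    for A B C :: "'a set" by auto
  have b: "(cl_basis A \<star> cl_basis B) \<star> cl_basis C = cl_basis A \<star> (cl_basis B \<star> cl_basis C)"
    for A B C :: "'a set"
    by (simp only: cl_mult_basis lin cl_sign_symdiff_left cl_sign_symdiff_right symdiff_assoc
        scaleR_scaleR mult_ac)
  have b2: "(cl_basis A \<star> cl_basis B) \<star> z = cl_basis A \<star> (cl_basis B \<star> z)" for A B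
    by (rule cl_linear_eqI[where x = z]) (auto intro!: linearI simp: lin b)
  have b1: "(cl_basis A \<star> y) \<star> z = cl_basis A \<star> (y \<star> z)" for A
    by (rule cl_linear_eqI[where x = y]) (auto intro!: linearI simp: lin b2)
  show ?thesis
    by (rule cl_linear_eqI[where x = x]) (auto intro!: linearI simp: lin b1)
qed

lemma cl_gen_anticommute:
  "cl_gen i \<star> cl_gen j + cl_gen j \<star> cl_gen i = (if i = j then - 2 else 0) *\<^sub>R cl_one"
proof -
  have pairs: "{(k, l). k \<in> {a} \<and> l \<in> {b} \<and> l \<le> k} = (if b \<le> a then {(a, b)} else {})"
    for a b :: 'a by auto
  have sym: "({i} - {j}) \<union> ({j} - {i}) = ({j} - {i}) \<union> ({i} - {j})" by auto
  show ?thesis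
  proof (cases "i = j")
    case True
    then show ?thesis
      unfolding cl_mult_basis cl_sign_def pairs
      by (simp add: vec_eq_iff)
  next
    case False
    then show ?thesis
      unfolding cl_mult_basis cl_sign_def pairs sym by auto
  qed
qed

lemma cl_basis_insert:
  assumes "\<And>j. j \<in> A \<Longrightarrow> i < j"
  shows "cl_basis (insert i A) = cl_gen i \<star> cl_basis A"
proof -
  have "{(k, j). k \<in> {i} \<and> j \<in> A \<and> j \<le> k} = {}" "({i} - A) \<union> (A - {i}) = insert i A"
    using assms by fastforce+
  then show ?thesis by (simp only: cl_mult_basis cl_sign_def) simp
qed


section \<open>Paravectors and domains\<close>

text \<open>A point (x_0, x) stands for the paravector x_0 + x; thus u + I v is (u, v I).\<close>

type_synonym 'n paravec = "real \<times> (real ^ 'n)"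

definition domain_in :: "'a::topological_space set \<Rightarrow> 'a set \<Rightarrow> bool" where
  "domain_in X W \<longleftrightarrow> openin (top_of_set X) W \<and> connected W \<and> W \<noteq> {}"

abbreviation unit_vectors :: "(real ^ 'n) set" where
  "unit_vectors \<equiv> sphere 0 1"

definition real_axis :: "('n::finite) paravec set" where
  "real_axis = {(u, 0) | u. True}"

definition slice_plane :: "real ^ 'n \<Rightarrow> ('n::finite) paravec set" where
  "slice_plane I = {(u, v *\<^sub>R I) | u v. True}"

definition s_domain :: "('n::finite) paravec set \<Rightarrow> bool" where
  "s_domain W \<longleftrightarrow> domain_in UNIV W \<and> W \<inter> real_axis \<noteq> {} \<and>
     (\<forall>I\<in>unit_vectors. domain_in (slice_plane I) (W \<inter> slice_plane I))"

definition axially_symmetric :: "('n::finite) paravec set \<Rightarrow> bool" where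
  "axially_symmetric W \<longleftrightarrow> (\<forall>u v. \<forall>I\<in>unit_vectors. (u, v *\<^sub>R I) \<in> W \<longrightarrow>
     (\<forall>J\<in>unit_vectors. (u, v *\<^sub>R J) \<in> W))"


section \<open>Differentiability\<close>

text \<open>Used for open sets only.\<close>

definition C1_on ::
  "'a::real_normed_vector set \<Rightarrow> ('a \<Rightarrow> 'b::real_normed_vector) \<Rightarrow> bool" where
  "C1_on S f \<longleftrightarrow> (\<exists>f' :: 'a \<Rightarrow> 'a \<Rightarrow>\<^sub>L 'b.
     (\<forall>x\<in>S. (f has_derivative blinfun_apply (f' x)) (at x)) \<and> continuous_on S f')"

definition C1_diffeo ::
  "'a::real_normed_vector set \<Rightarrow> 'b::real_normed_vector set \<Rightarrow> ('a \<Rightarrow> 'b) \<Rightarrow> bool" where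
  "C1_diffeo U V g \<longleftrightarrow> bij_betw g U V \<and> C1_on U g \<and> C1_on V (inv_into U g)"

text \<open>Partial derivative at x in the coordinate direction b.\<close>

definition partial_deriv ::
  "'a::real_normed_vector \<Rightarrow> ('a \<Rightarrow> 'b::real_normed_vector) \<Rightarrow> 'a \<Rightarrow> 'b" where
  "partial_deriv b f x = vector_derivative (\<lambda>h. f (x + h *\<^sub>R b)) (at 0)"


section \<open>Slice monogenic functions\<close>

text \<open>In both definitions W is meant to be open, and axially symmetric in the second.\<close>

definition SM ::
  "('n::{finite,linorder}) paravec set \<Rightarrow> ('n paravec \<Rightarrow> 'n clifford) set" where
  "SM W = {h. h differentiable_on W \<and>
     (\<forall>I\<in>unit_vectors. \<forall>u v. (u, v *\<^sub>R I) \<in> W \<longrightarrow>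
        partial_deriv (1, 0) (\<lambda>(u, v). h (u, v *\<^sub>R I)) (u, v)
        + cl_vec I \<star> partial_deriv (0, 1) (\<lambda>(u, v). h (u, v *\<^sub>R I)) (u, v) = 0)}"

definition slice_params :: "('n::finite) paravec set \<Rightarrow> (real \<times> real) set" where
  "slice_params W = {(u, v). \<exists>I\<in>unit_vectors. (u, v *\<^sub>R I) \<in> W}"

definition HM ::
  "('n::{finite,linorder}) paravec set \<Rightarrow> ('n paravec \<Rightarrow> 'n clifford) set" where
  "HM W = {h. \<exists>\<alpha> \<beta>. \<alpha> differentiable_on slice_params W \<and> \<beta> differentiable_on slice_params W \<and>
     (\<forall>I\<in>unit_vectors. \<forall>u v. (u, v *\<^sub>R I) \<in> W \<longrightarrow>
        h (u, v *\<^sub>R I) = \<alpha> (u, v) + cl_vec I \<star> \<beta> (u, v)) \<and>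
     (\<forall>(u, v) \<in> slice_params W.
        \<alpha> (u, v) = \<alpha> (u, - v) \<and> \<beta> (u, v) = - \<beta> (u, - v) \<and>
        partial_deriv (1, 0) \<alpha> (u, v) - partial_deriv (0, 1) \<beta> (u, v) = 0 \<and>
        partial_deriv (0, 1) \<alpha> (u, v) + partial_deriv (1, 0) \<beta> (u, v) = 0)}"


section \<open>The map a, its inverse and the operator\<close>

text \<open>
  Here g is the vector part of the map a, a bijection from U onto V; its inverse is taken on V.
\<close>

definition para_map :: "(real ^ 'n \<Rightarrow> real ^ 'n) \<Rightarrow> 'n paravec \<Rightarrow> ('n::finite) paravec" where
  "para_map g x = (fst x, g (snd x))"

definition para_inv ::
  "(real ^ 'n) set \<Rightarrow> (real ^ 'n \<Rightarrow> real ^ 'n) \<Rightarrow> 'n paravec \<Rightarrow> ('n::finite) paravec" where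
  "para_inv U g y = (fst y, inv_into U g (snd y))"

definition H_op ::
  "(real ^ ('n::{finite,linorder})) set \<Rightarrow> (real ^ 'n::{finite,linorder} \<Rightarrow> real ^ 'n::{finite,linorder})
    \<Rightarrow> ('n paravec \<Rightarrow> 'n clifford) \<Rightarrow> 'n paravec \<Rightarrow> 'n clifford" where
  "H_op U g f x =
     cl_vec (g (snd x)) \<star> partial_deriv (1, 0) f x
     - (\<Sum>i\<in>UNIV. (\<Sum>j\<in>UNIV. g (snd x) $ j *
            partial_deriv (axis j 1) (\<lambda>y. inv_into U g y $ i) (g (snd x)))
          *\<^sub>R partial_deriv (0, axis i 1) f x)"

end

theory Submission
  imports Defs
begin

text \<open>
  Write h for f composed with the inverse of a, w for the vector part of a(x), and D for the
  derivative at w of the inverse of the vector part of a. By the chain rule h'(p, q) = f'(p, D q),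
  so that H_a[f](x) is w times h'(1, 0) minus h'(0, w). For w = v I this is v I times the
  slice Cauchy-Riemann expression of h, because I squared is -1; for w = 0 it vanishes trivially.
  On an axially symmetric open set a differentiable function of class HM is of class SM.
\<close>

lemma cl_vec_scaleR: "cl_vec (c *\<^sub>R v) = c *\<^sub>R cl_vec v"
  by (simp add: cl_vec_def scaleR_sum_right)

lemma cl_mult_zero_left [simp]: "0 \<star> x = 0"
  by (rule bilinear_lzero[OF bilinear_cl_mult])

lemma cl_mult_minus_right: "x \<star> (- y) = - (x \<star> y)"
  by (rule bilinear_rneg[OF bilinear_cl_mult])

lemma cl_mult_sum_left: "(\<Sum>i\<in>S. f i) \<star> y = (\<Sum>i\<in>S. f i \<star> y)"
  using bilinear_cl_mult unfolding bilinear_def by (intro linear_sum[where f = "\<lambda>x. x \<star> y"]) auto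

lemma cl_mult_sum_right: "x \<star> (\<Sum>i\<in>S. f i) = (\<Sum>i\<in>S. x \<star> f i)"
  using bilinear_cl_mult unfolding bilinear_def by (intro linear_sum[where f = "\<lambda>y. x \<star> y"]) auto

text \<open>Left multiplication by \<open>c\<close> is linear on a finite-dimensional space, hence
  bounded, and so commutes with differentiation.\<close>

lemma has_derivative_cl_mult_right:
  assumes "(f has_derivative f') F"
  shows "((\<lambda>x. c \<star> f x) has_derivative (\<lambda>x. c \<star> f' x)) F"
proof -
  have "linear (\<lambda>x. c \<star> x)"
    using bilinear_cl_mult unfolding bilinear_def by auto
  then show ?thesis
    by (intro bounded_linear.has_derivative[OF _ assms]) (simp add: linear_linear)
qed

text \<open>Adding the double sum to its transpose produces the anticommutators of the generators:
  the terms with distinct indices cancel, and each diagonal term contributes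
  \<open>- 2 * (v $ i)\<^sup>2\<close>, so half of the total is minus the squared norm.\<close>

lemma cl_vec_square: "cl_vec v \<star> cl_vec v = - (norm v)\<^sup>2 *\<^sub>R cl_one"
proof -
  let ?T = "\<lambda>i j. (v $ i * v $ j) *\<^sub>R (cl_gen i \<star> cl_gen j)"
  have S: "cl_vec v \<star> cl_vec v = (\<Sum>i\<in>UNIV. \<Sum>j\<in>UNIV. ?T i j)"
    by (subst sum.swap) (simp add: cl_vec_def cl_mult_sum_left cl_mult_sum_right
        cl_mult_scale_left cl_mult_scale_right scaleR_sum_right mult.commute)
  also have "\<dots> = (\<Sum>i\<in>UNIV. \<Sum>j\<in>UNIV. ?T j i)"
    by (rule sum.swap)
  finally have "2 *\<^sub>R (cl_vec v \<star> cl_vec v) = (\<Sum>i\<in>UNIV. \<Sum>j\<in>UNIV. ?T i j + ?T j i)"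
    using S by (simp add: scaleR_2 sum.distrib)
  also have "\<dots> = (\<Sum>i\<in>UNIV. \<Sum>j\<in>UNIV. (v $ i * v $ j)
      *\<^sub>R (if i = j then - 2 else 0) *\<^sub>R cl_one)"
    by (intro sum.cong refl) (simp add: cl_gen_anticommute[symmetric] scaleR_add_right mult.commute)
  also have "\<dots> = (\<Sum>i\<in>UNIV. (- 2 * (v $ i)\<^sup>2) *\<^sub>R cl_one)"
  proof (intro sum.cong refl)
    fix i
    have "(\<Sum>j\<in>UNIV. (v $ i * v $ j) *\<^sub>R (if i = j then - 2 else 0) *\<^sub>R cl_one)
        = (\<Sum>j\<in>UNIV. if i = j then (- 2 * (v $ i)\<^sup>2) *\<^sub>R cl_one else (0 :: 'a clifford))"
      by (intro sum.cong refl) (simp add: power2_eq_square)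
    then show "(\<Sum>j\<in>UNIV. (v $ i * v $ j) *\<^sub>R (if i = j then - 2 else 0) *\<^sub>R cl_one)
        = (- 2 * (v $ i)\<^sup>2) *\<^sub>R (cl_one :: 'a clifford)"
      by simp
  qed
  also have "\<dots> = 2 *\<^sub>R (- (norm v)\<^sup>2 *\<^sub>R cl_one)"
    by (simp add: scaleR_sum_left[symmetric] sum_negf sum_distrib_left[symmetric] norm_vec_def
        L2_set_def sum_nonneg)
  finally show ?thesis unfolding scaleR_cancel_left by simp
qed

lemma cl_vec_mult_unit:
  assumes "norm v = 1"
  shows "cl_vec v \<star> (cl_vec v \<star> x) = - x"
proof -
  have "cl_vec v \<star> (cl_vec v \<star> x) = (- 1 *\<^sub>R cl_one) \<star> x"
    using assms by (simp add: cl_mult_assoc[symmetric] cl_vec_square)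
  then show ?thesis by (simp only: cl_mult_scale_left cl_one_left) simp
qed

text \<open>\<open>partial_deriv\<close> rests on a choice of derivative along a line. A known total
  derivative fixes that value by the chain rule, so every later computation can be done with linear
  maps.\<close>

lemma partial_deriv_eq:
  assumes "(f has_derivative f') (at x)"
  shows "partial_deriv b f x = f' b"
proof -
  have "((\<lambda>h. x + h *\<^sub>R b) has_derivative (\<lambda>h. h *\<^sub>R b)) (at 0)"
    by (auto intro!: derivative_eq_intros)
  from has_derivative_compose[OF this, of f f'] assms
  have "((\<lambda>h. f (x + h *\<^sub>R b)) has_derivative (\<lambda>h. f' (h *\<^sub>R b))) (at 0)" by simp
  moreover have "f' (h *\<^sub>R b) = h *\<^sub>R f' b" for h
    using assms by (simp add: has_derivative_bounded_linear linear_simps(5))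
  ultimately have "((\<lambda>h. f (x + h *\<^sub>R b)) has_vector_derivative f' b) (at 0)"
    by (simp add: has_vector_derivative_def)
  then show ?thesis
    unfolding partial_deriv_def by (rule vector_derivative_at)
qed

lemma has_derivative_slice:
  assumes "(h has_derivative h') (at (u, v *\<^sub>R I))"
  shows "((\<lambda>(u, v). h (u, v *\<^sub>R I)) has_derivative (\<lambda>(p, q). h' (p, q *\<^sub>R I))) (at (u, v))"
proof -
  have "((\<lambda>z. (fst z, snd z *\<^sub>R I)) has_derivative (\<lambda>z. (fst z, snd z *\<^sub>R I))) (at (u, v))"
    by (auto intro!: derivative_eq_intros)
  from has_derivative_compose[OF this, of h h'] assms show ?thesis
    by (simp add: case_prod_beta')
qed

text \<open>By axial symmetry a single unit vector already detects every parameter pair. The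
  existential over directions thus becomes a preimage under one continuous map, from which openness
  follows.\<close>

lemma slice_params_eq:
  assumes "axially_symmetric W" "I \<in> unit_vectors"
  shows "slice_params W = (\<lambda>z. (fst z, snd z *\<^sub>R I)) -` W"
  using assms unfolding slice_params_def axially_symmetric_def
  by (fastforce simp del: mem_sphere_0)

lemma open_slice_params:
  fixes W :: "('n::finite) paravec set" and I :: "real ^ 'n"
  assumes "open W" "axially_symmetric W" "I \<in> unit_vectors"
  shows "open (slice_params W)"
  unfolding slice_params_eq[OF assms(2,3)]
  by (intro open_vimage assms(1) continuous_intros)

text \<open>On the slice of \<open>I\<close> the function is \<alpha> + I \<beta>, so the
  Cauchy-Riemann system for \<alpha> and \<beta> becomes the slice equation. \<open>HM\<close>
  provides derivatives of \<alpha> and \<beta> only, whereas \<open>SM\<close> asks for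
  differentiability of \<open>h\<close> itself; hence the separate hypothesis.\<close>

lemma HM_imp_SM:
  assumes W: "open W" "axially_symmetric W" and diff: "h differentiable_on W" and "h \<in> HM W"
  shows "h \<in> SM W"
proof -
  from \<open>h \<in> HM W\<close> obtain \<alpha> \<beta> where
    ab: "\<alpha> differentiable_on slice_params W" "\<beta> differentiable_on slice_params W"
    and hab: "\<And>I u v. I \<in> unit_vectors \<Longrightarrow> (u, v *\<^sub>R I) \<in> W \<Longrightarrow>
        h (u, v *\<^sub>R I) = \<alpha> (u, v) + cl_vec I \<star> \<beta> (u, v)"
    and CR: "\<And>u v. (u, v) \<in> slice_params W \<Longrightarrow>
        partial_deriv (1, 0) \<alpha> (u, v) - partial_deriv (0, 1) \<beta> (u, v) = 0 \<and>
        partial_deriv (0, 1) \<alpha> (u, v) + partial_deriv (1, 0) \<beta> (u, v) = 0"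
    unfolding HM_def by blast
  have "partial_deriv (1, 0) (\<lambda>(u, v). h (u, v *\<^sub>R I)) (u, v)
      + cl_vec I \<star> partial_deriv (0, 1) (\<lambda>(u, v). h (u, v *\<^sub>R I)) (u, v) = 0"
    if I: "I \<in> unit_vectors" and uv: "(u, v *\<^sub>R I) \<in> W" for I u v
  proof -
    let ?g = "\<lambda>z. \<alpha> z + cl_vec I \<star> \<beta> z"
    \<comment> \<open>Openness serves twice: it turns differentiability on the set into derivatives
      at the point, and it lets the derivative of \<open>?g\<close> pass to the slice of
      \<open>h\<close>, which agrees with \<open>?g\<close> on this set.\<close>
    have op: "open (slice_params W)" using open_slice_params[OF W I] .
    have mem: "(u, v) \<in> slice_params W" using uv I by (auto simp: slice_params_def)
    obtain \<alpha>' \<beta>' where d: "(\<alpha> has_derivative \<alpha>') (at (u, v))" "(\<beta> has_derivative \<beta>') (at (u, v))"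
      using ab mem op unfolding differentiable_on_def differentiable_def
      by (metis at_within_open)
    have "(?g has_derivative (\<lambda>z. \<alpha>' z + cl_vec I \<star> \<beta>' z)) (at (u, v))"
      by (intro has_derivative_add has_derivative_cl_mult_right d)
    moreover have "?g z = (\<lambda>(u, v). h (u, v *\<^sub>R I)) z" if "z \<in> slice_params W" for z
      using that hab[OF I] by (auto simp: slice_params_eq[OF W(2) I] case_prod_beta)
    ultimately have "((\<lambda>(u, v). h (u, v *\<^sub>R I)) has_derivative
        (\<lambda>z. \<alpha>' z + cl_vec I \<star> \<beta>' z)) (at (u, v))"
      using has_derivative_transform_within_open op mem by blast
    note pd = partial_deriv_eq[OF this] partial_deriv_eq[OF d(1)] partial_deriv_eq[OF d(2)]
    have "\<alpha>' (1, 0) = \<beta>' (0, 1)" and "\<beta>' (1, 0) = - \<alpha>' (0, 1)"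
      using CR[OF mem] by (auto simp: pd eq_neg_iff_add_eq_0 add.commute)
    \<comment> \<open>Since I squared is -1, the slice expression equals (\<alpha>'(1,0) -
      \<beta>'(0,1)) + I (\<beta>'(1,0) + \<alpha>'(0,1)), and both brackets vanish.\<close>
    then show ?thesis
      using I by (simp add: pd cl_mult_add_right cl_vec_mult_unit cl_mult_minus_right)
  qed
  then show ?thesis using diff by (auto simp: SM_def)
qed

text \<open>This is the slice equation multiplied from the left by \<open>w\<close>, which removes
  the choice of a direction. In this form it also makes sense on the real axis, where both sides are
  zero.\<close>

lemma SM_radial_derivative:
  assumes "h \<in> SM W" "(u, w) \<in> W" "(h has_derivative h') (at (u, w))"
  shows "cl_vec w \<star> h' (1, 0) = h' (0, w)"
proof (cases "w = 0")
  case True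
  have "h' (0, 0) = 0"
    using linear_simps(3)[OF has_derivative_bounded_linear[OF assms(3)]] by (simp add: zero_prod_def)
  then show ?thesis using True by (simp add: cl_vec_def)
next
  case False
  \<comment> \<open>The point lies in the slice of its own direction, with parameter v =
    \<open>norm w\<close>.\<close>
  define I where "I = w /\<^sub>R norm w"
  have I: "norm I = 1" and w: "norm w *\<^sub>R I = w"
    using False by (auto simp: I_def)
  have "partial_deriv (1, 0) (\<lambda>(u, v). h (u, v *\<^sub>R I)) (u, norm w)
      + cl_vec I \<star> partial_deriv (0, 1) (\<lambda>(u, v). h (u, v *\<^sub>R I)) (u, norm w) = 0"
    using assms(1,2) I unfolding SM_def by (auto simp: w)
  moreover have "(h has_derivative h') (at (u, norm w *\<^sub>R I))"
    using assms(3) by (simp add: w)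
  note pd = partial_deriv_eq[OF has_derivative_slice[OF this]]
  ultimately have "h' (1, 0) = - (cl_vec I \<star> h' (0, I))"
    by (simp add: pd add_eq_0_iff2)
  then have "cl_vec I \<star> h' (1, 0) = h' (0, I)"
    using I by (simp add: cl_mult_minus_right cl_vec_mult_unit)
  then have "cl_vec (norm w *\<^sub>R I) \<star> h' (1, 0) = norm w *\<^sub>R h' (0, I)"
    by (simp add: cl_vec_scaleR cl_mult_scale_left)
  also have "\<dots> = h' (norm w *\<^sub>R (0, I))"
    using assms(3) by (simp only: has_derivative_bounded_linear linear_simps(5))
  also have "\<dots> = h' (0, w)" using w by simp
  finally show ?thesis by (simp only: w)
qed

text \<open>The inner sum over j is the i-th coordinate of \<open>D\<close> applied to
  \<open>g (snd x)\<close>. By linearity of \<open>f'\<close> the outer sum is then one directional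
  derivative of \<open>f\<close>, and all coordinates disappear from the operator.\<close>

lemma H_op_eq:
  assumes f: "(f has_derivative f') (at x)"
    and D: "(inv_into U g has_derivative D) (at (g (snd x)))"
  shows "H_op U g f x = cl_vec (g (snd x)) \<star> f' (1, 0) - f' (0, D (g (snd x)))"
proof -
  let ?w = "g (snd x)"
  interpret f': bounded_linear f' using f by (rule has_derivative_bounded_linear)
  interpret D: bounded_linear D using D by (rule has_derivative_bounded_linear)
  have "((\<lambda>y. inv_into U g y $ i) has_derivative (\<lambda>y. D y $ i)) (at ?w)" for i
    by (rule bounded_linear.has_derivative[OF bounded_linear_vec_nth D])
  note pd = partial_deriv_eq[OF this] partial_deriv_eq[OF f]
  have Dw: "(\<Sum>j\<in>UNIV. ?w $ j * D (axis j 1) $ i) = D ?w $ i" for i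
  proof -
    have "D ?w = D (\<Sum>j\<in>UNIV. ?w $ j *\<^sub>R axis j 1)"
      using basis_expansion[of ?w] by (simp add: scalar_mult_eq_scaleR)
    then show ?thesis by (simp add: D.sum D.scaleR)
  qed
  have "(\<Sum>i\<in>UNIV. z $ i *\<^sub>R f' (0, axis i 1)) = f' (0, z)" for z
  proof -
    have "f' (0, z) = f' (\<Sum>i\<in>UNIV. z $ i *\<^sub>R (0, axis i 1))"
      using basis_expansion[of z]
      by (intro arg_cong[of _ _ f'])
         (simp add: prod_eq_iff fst_sum snd_sum scalar_mult_eq_scaleR)
    also have "\<dots> = (\<Sum>i\<in>UNIV. z $ i *\<^sub>R f' (0, axis i 1))"
      by (simp only: f'.sum f'.scaleR)
    finally show ?thesis ..
  qed
  then show ?thesis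
    unfolding H_op_def pd Dw by simp
qed

text \<open>\<open>para_inv\<close> keeps the scalar part, so its derivative acts as the identity
  there and as \<open>D\<close> on the vector part.\<close>

lemma has_derivative_comp_para_inv:
  assumes "(f has_derivative f') (at (para_inv U g y))"
    and "(inv_into U g has_derivative D) (at (snd y))"
  shows "(f \<circ> para_inv U g has_derivative (\<lambda>(p, q). f' (p, D q))) (at y)"
proof -
  have "((\<lambda>y. (fst y, inv_into U g (snd y))) has_derivative (\<lambda>z. (fst z, D (snd z)))) (at y)"
    by (intro has_derivative_Pair has_derivative_fst has_derivative_ident
        has_derivative_compose[OF has_derivative_snd[OF has_derivative_ident] assms(2)])
  then have "(para_inv U g has_derivative (\<lambda>z. (fst z, D (snd z)))) (at y)"
    by (simp add: para_inv_def[abs_def])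
  from diff_chain_at[OF this assms(1)] show ?thesis
    by (simp add: o_def case_prod_beta')
qed

lemma C1_on_has_derivative:
  assumes "C1_on S f" "x \<in> S"
  obtains f' where "(f has_derivative f') (at x)"
  using assms unfolding C1_on_def by blast

theorem proposition3p7:
  fixes U V :: "(real ^ 'n::{finite,linorder}) set"
    and s t :: ereal
    and a_vec :: "real ^ 'n::{finite,linorder} \<Rightarrow> real ^ 'n::{finite,linorder}"
    and f :: "'n paravec \<Rightarrow> 'n clifford"
  assumes "domain_in UNIV U" and "domain_in UNIV V"
    and "s < t"
    and "C1_diffeo U V a_vec"
    and "para_map a_vec ` (einterval s t \<times> U) = einterval s t \<times> V"
    and "axially_symmetric (einterval s t \<times> V)"
    and "s_domain (einterval s t \<times> V)"
    and "C1_on (einterval s t \<times> U) f"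
  shows "(f \<circ> para_inv U a_vec \<in> SM (einterval s t \<times> V) \<longrightarrow>
            (\<forall>x \<in> einterval s t \<times> U. H_op U a_vec f x = 0)) \<and>
         (f \<circ> para_inv U a_vec \<in> HM (einterval s t \<times> V) \<longrightarrow>
            (\<forall>x \<in> einterval s t \<times> U. H_op U a_vec f x = 0))"
proof -
  let ?J = "einterval s t" and ?h = "f \<circ> para_inv U a_vec"
  have bij: "bij_betw a_vec U V" and inv: "C1_on V (inv_into U a_vec)"
    using assms(4) by (auto simp: C1_diffeo_def)
  have "open (?J \<times> V)"
    using assms(2) by (auto simp: domain_in_def intro!: open_Times open_einterval)
  \<comment> \<open>Differentiability of the composite comes from the C1 hypotheses on
    \<open>f\<close> and on the inverse of \<open>a_vec\<close>; the passage from \<open>HM\<close>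
    to \<open>SM\<close> relies on it.\<close>
  have diff: "?h differentiable_on ?J \<times> V"
  proof (rule differentiable_at_imp_differentiable_on)
    fix y assume y: "y \<in> ?J \<times> V"
    then have x: "para_inv U a_vec y \<in> ?J \<times> U" and "snd y \<in> V"
      using bij by (auto simp: para_inv_def bij_betw_def inv_into_into)
    obtain f' where f': "(f has_derivative f') (at (para_inv U a_vec y))"
      using C1_on_has_derivative[OF assms(8) x] .
    obtain D where D: "(inv_into U a_vec has_derivative D) (at (snd y))"
      using C1_on_has_derivative[OF inv \<open>snd y \<in> V\<close>] .
    show "?h differentiable (at y)"
      using has_derivative_comp_para_inv[OF f' D] by (rule differentiableI)
  qed
  have SM: "H_op U a_vec f x = 0" if h: "?h \<in> SM (?J \<times> V)" and x: "x \<in> ?J \<times> U" for x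
  proof -
    let ?y = "(fst x, a_vec (snd x))"
    have y: "?y \<in> ?J \<times> V" "a_vec (snd x) \<in> V" "para_inv U a_vec ?y = x"
      using x bij by (auto simp: para_inv_def bij_betw_def)
    obtain f' where f': "(f has_derivative f') (at x)"
      using C1_on_has_derivative[OF assms(8) x] .
    obtain D where D: "(inv_into U a_vec has_derivative D) (at (a_vec (snd x)))"
      using C1_on_has_derivative[OF inv y(2)] .
    \<comment> \<open>The derivative of \<open>?h\<close> in the direction (1, 0) comes out as
      \<open>f' (1, D 0)\<close>, which has to match the term \<open>f' (1, 0)\<close> of the
      operator.\<close>
    have "D 0 = 0" by (rule linear_simps(3)[OF has_derivative_bounded_linear[OF D]])
    have "(?h has_derivative (\<lambda>(p, q). f' (p, D q))) (at ?y)"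
      using has_derivative_comp_para_inv[of f f' U a_vec ?y D] f' D y(3) by simp
    from SM_radial_derivative[OF h y(1) this]
    show ?thesis
      using \<open>D 0 = 0\<close> by (simp add: H_op_eq[OF f' D])
  qed
  \<comment> \<open>The \<open>HM\<close> claim reduces to the \<open>SM\<close> claim just
    proved.\<close>
  then show ?thesis
    using HM_imp_SM[OF \<open>open (?J \<times> V)\<close> assms(6) diff] by blast
qed

end
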